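(* Let $H,K$ be events with $H\neq\emptyset$, $K\neq\emptyset$ and $H\subseteq K$, let $X$ be a finite random quantity, and let all previsions involved (of $X|H$, $X|HK$ and $(X|H)|K$) form a coherent assessment. Then $$(X|H)|K = X|HK = X|H .$$
   Context: Events are identified with their indicators (value 1 if true, 0 if false); $\emptyset$ is the impossible event, $H^c$ the negation of $H$, juxtaposition denotes conjunction (product of indicators), and $H\subseteq K$ means that $H$ logically implies $K$, i.e. $HK^c=\emptyset$. A finite random quantity is a real quantity with finitely many possible values (a finitely-valued real function of the possible outcomes). Equality of random quantities means that they take the same value in every possible outcome. For an event $H\neq\emptyset$ and a finite random quantity $X$ with assessed conditional prevision $\mathbb{P}(X|H)=\mu\in\mathbb{R}$, the conditional random quantity $X|H$ is the random quantity $X|H = XH+\mu H^c$. Iterated conditional random quantity: with $x=\mathbb{P}(X|H)$, one defines $(X|H)|K=(XH+xH^c)|K$. Coherence: a real function $\mathbb{P}$ on a family $\mathcal{K}$ of finite conditional random quantities is coherent iff for all $n\ge1$, all $X_1|H_1,\dots,X_n|H_n\in\mathcal{K}$ and all real $s_1,\dots,s_n$, setting $\mu_i=\mathbb{P}(X_i|H_i)$ and $\mathcal{G}=\sum_{i=1}^n s_iH_i(X_i-\mu_i)$, the minimum and maximum of the values of $\mathcal{G}$ over the outcomes where $H_1\vee\cdots\vee H_n$ is true satisfy $\min\mathcal{G}\le 0\le\max\mathcal{G}$. *)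

theory Defs
  imports Complex_Main "HOL-Library.Indicator_Function"
begin

text \<open>
  The type \<open>'w\<close> is the type of possible outcomes. Events are sets of outcomes, so logical
  implication is inclusion and conjunction is intersection; random quantities are real functions
  on outcomes, so equality of random quantities is equality of functions.
\<close>

type_synonym 'w event = "'w set"
type_synonym 'w rquantity = "'w \<Rightarrow> real"

text \<open>
  A prevision assessment gives a number to each pair \<open>(X, H)\<close>, read as \<open>X|H\<close>. It is a total
  function here, but only its values on the family under consideration carry meaning.
\<close>

type_synonym 'w assessment = "'w rquantity \<times> 'w event \<Rightarrow> real"

definition finite_rquantity :: "'w rquantity \<Rightarrow> bool" where
  "finite_rquantity X \<longleftrightarrow> finite (range X)"

definition cond_rquantity :: "'w assessment \<Rightarrow> 'w rquantity \<Rightarrow> 'w event \<Rightarrow> 'w rquantity" where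
  "cond_rquantity P X H = (\<lambda>w. X w * indicator H w + P (X, H) * indicator (- H) w)"

definition iterated_cond ::
  "'w assessment \<Rightarrow> 'w rquantity \<Rightarrow> 'w event \<Rightarrow> 'w event \<Rightarrow> 'w rquantity" where
  "iterated_cond P X H K = cond_rquantity P (cond_rquantity P X H) K"

definition random_gain ::
  "'w assessment \<Rightarrow> nat \<Rightarrow> (nat \<Rightarrow> 'w rquantity) \<Rightarrow> (nat \<Rightarrow> 'w event) \<Rightarrow> (nat \<Rightarrow> real) \<Rightarrow> 'w rquantity"
where
  "random_gain P n X H s =
     (\<lambda>w. \<Sum>i = 1..n. s i * indicator (H i) w * (X i w - P (X i, H i)))"

text \<open>
  The first conjunct says that the family consists of finite conditional random quantities.
  It makes the set of gains in the second conjunct finite and nonempty, so that \<open>Min\<close> and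
  \<open>Max\<close> have their intended meaning.
\<close>

definition coherent :: "('w rquantity \<times> 'w event) set \<Rightarrow> 'w assessment \<Rightarrow> bool" where
  "coherent F P \<longleftrightarrow>
     (\<forall>(X, H) \<in> F. finite_rquantity X \<and> H \<noteq> {}) \<and>
     (\<forall>n \<ge> 1. \<forall>X H s. (\<forall>i \<in> {1..n}. (X i, H i) \<in> F) \<longrightarrow>
        Min (random_gain P n X H s ` (\<Union>i \<in> {1..n}. H i)) \<le> 0 \<and>
        0 \<le> Max (random_gain P n X H s ` (\<Union>i \<in> {1..n}. H i)))"

end

theory Submission
  imports Defs
begin

text \<open>
  Since \<open>H \<inter> K = H\<close>, the second equality is immediate, and the first one asks for
  \<open>(X|H)|K = X|H\<close>. The two sides agree on \<open>K\<close> by definition. Outside \<open>K\<close>, hence outside \<open>H\<close>, they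
  are the constants \<open>y = \<P>((X|H)|K)\<close> and \<open>x = \<P>(X|H)\<close>, so everything rests on \<open>y = x\<close>. To see
  this, bet \<open>1\<close> on \<open>X|H\<close> and \<open>-1\<close> on \<open>(X|H)|K\<close>: on \<open>H\<close> the gain is \<open>(X - x) - (X - y) = y - x\<close>,
  and on \<open>K - H\<close>, where only the second bet is active and \<open>X|H\<close> is worth \<open>x\<close>, it is
  \<open>-(x - y) = y - x\<close>. A gain that is constant wherever a bet is active must vanish by coherence
  (\<open>coherent_constant_gain\<close>).
\<close>

text \<open>The minimum and the maximum of the gain are then both \<open>c\<close>, and coherence puts \<open>0\<close> between them.\<close>

lemma coherent_constant_gain:
  assumes coh: "coherent F P" and n: "n \<ge> 1"
    and F: "\<And>i. i \<in> {1..n} \<Longrightarrow> (X i, H i) \<in> F"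
    and const: "\<And>w. w \<in> (\<Union>i \<in> {1..n}. H i) \<Longrightarrow> random_gain P n X H s w = c"
  shows "c = 0"
proof -
  let ?U = "\<Union>i \<in> {1..n}. H i"
  have ne: "\<forall>(X, H) \<in> F. finite_rquantity X \<and> H \<noteq> {}"
    and bound: "(\<forall>i \<in> {1..n}. (X i, H i) \<in> F) \<longrightarrow>
      Min (random_gain P n X H s ` ?U) \<le> 0 \<and> 0 \<le> Max (random_gain P n X H s ` ?U)"
    using coh n by (simp_all add: coherent_def)
  have one: "1 \<in> {1..n}" using n by simp
  then have "H 1 \<noteq> {}" using bspec[OF ne F[OF one]] by simp
  with one have "?U \<noteq> {}" by blast
  moreover have "random_gain P n X H s ` ?U = (\<lambda>w. c) ` ?U"
    by (rule image_cong) (simp_all only: const)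
  ultimately have "random_gain P n X H s ` ?U = {c}" by (simp only: image_constant_conv if_False)
  then show ?thesis using bound F by simp
qed

lemma coherent_prevision_iterated:
  assumes coh: "coherent F P" and "(X, H) \<in> F" and "(cond_rquantity P X H, K) \<in> F"
    and sub: "H \<subseteq> K"
  shows "P (cond_rquantity P X H, K) = P (X, H)"
proof -
  let ?Y = "cond_rquantity P X H"
  define Q where "Q i = (if i = 1 then X else ?Y)" for i :: nat
  define E where "E i = (if i = 1 then H else K)" for i :: nat
  define s where "s i = (if i = 1 then 1 else - 1 :: real)" for i :: nat
  have two: "{1..2} = {1, 2 :: nat}" by auto
  have gain: "random_gain P 2 Q E s w =
      indicator H w * (X w - P (X, H)) - indicator K w * (?Y w - P (?Y, K))" for w
    unfolding random_gain_def two by (simp add: Q_def E_def s_def)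
  have "P (?Y, K) - P (X, H) = 0"
  proof (rule coherent_constant_gain[OF coh, where n = 2 and X = Q and H = E and s = s])
    fix w assume "w \<in> (\<Union>i \<in> {1..2}. E i)"
    then have "w \<in> K" using sub by (auto simp: E_def split: if_splits)
    then show "random_gain P 2 Q E s w = P (?Y, K) - P (X, H)"
      unfolding gain by (cases "w \<in> H") (simp_all add: cond_rquantity_def)
  qed (use assms in \<open>auto simp: Q_def E_def\<close>)
  then show ?thesis by simp
qed

theorem mainTheorem7:
  fixes H K :: "'w event" and X :: "'w rquantity" and P :: "'w assessment"
  assumes "H \<noteq> {}" and "K \<noteq> {}" and "H \<subseteq> K"
    and "finite_rquantity X"
    and "coherent {(X, H), (X, H \<inter> K), (cond_rquantity P X H, K)} P"
  shows "iterated_cond P X H K = cond_rquantity P X (H \<inter> K) \<and>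
         cond_rquantity P X (H \<inter> K) = cond_rquantity P X H"
proof -
  have HK: "H \<inter> K = H" using \<open>H \<subseteq> K\<close> by blast
  have eq: "P (cond_rquantity P X H, K) = P (X, H)"
    by (rule coherent_prevision_iterated[OF assms(5)]) (use \<open>H \<subseteq> K\<close> in auto)
  have "iterated_cond P X H K w = cond_rquantity P X H w" for w
  proof (cases "w \<in> K")
    case True
    then show ?thesis by (simp add: iterated_cond_def cond_rquantity_def[of P _ K])
  next
    case False
    then have "w \<notin> H" using \<open>H \<subseteq> K\<close> by blast
    then have "cond_rquantity P X H w = P (X, H)" by (simp add: cond_rquantity_def)
    with False show ?thesis
      by (simp add: iterated_cond_def cond_rquantity_def[of P _ K] eq)
  qed
  then have "iterated_cond P X H K = cond_rquantity P X H" by (rule ext)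
  then show ?thesis unfolding HK by blast
qed

end
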